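(* The class $\mathcal K_\omega$ of all countable linear orders $(L,<)$ has the automorphic Borel amalgamation property (ABAP).
   Context: ABAP. Let $\mathcal K_\omega$ be a class of countable relational structures in a fixed countable relational language, closed under isomorphism; it is regarded as a standard Borel space in the usual way (coding structures with universe a subset of $\mathbb N$). For $A\in\mathcal K_\omega$, a quantifier-free type $\tau(x)$ in one free variable with finitely many parameters from $A$ is an admissible finite type over $A$ if there is $B\in\mathcal K_\omega$ with $A$ a substructure of $B$ and $B$ containing an element realizing $\tau$. The class $\mathcal K_\omega$ has the ABAP if there is a Borel map $E$ on $\mathcal K_\omega$ such that: (a) for every $A\in\mathcal K_\omega$, $E(A)\in\mathcal K_\omega$ is an extension of $A$ containing witnesses for all admissible finite types over $A$; (b) there is a Borel assignment $(A,\phi)\mapsto\tilde\phi$, from pairs with $A\in\mathcal K_\omega$ and $\phi\in\mathrm{Aut}(A)$, to $\tilde\phi\in\mathrm{Aut}(E(A))$ such that $\phi\subseteq\tilde\phi$ and $\tilde\phi$ has no fixed points in $E(A)\setminus A$; (c) there is an assignment $(A_0,A_1,\alpha)\mapsto\hat\alpha$, from triples with $A_i\in\mathcal K_\omega$ and $\alpha\colon A_0\cong A_1$ an isomorphism, to isomorphisms $\hat\alpha\colon E(A_0)\cong E(A_1)$ extending $\alpha$, such that whenever $\phi_i\in\mathrm{Aut}(A_i)$ and $\alpha\phi_0=\phi_1\alpha$, we have $\hat\alpha\tilde\phi_0=\tilde\phi_1\hat\alpha$. *)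

theory Defs
  imports "HOL-Analysis.Analysis"
begin

text \<open>
  A countable structure in the language with relation symbols \<open>'r\<close> and arities \<open>ar\<close> is coded by
  the indicator functions of its universe (a subset of the natural numbers, possibly finite or
  empty) and of its relations. The codes carry the product topology, all the factors being discrete,
  and hence the usual Borel structure.
\<close>

instance bool :: second_countable_topology
proof
  have "open = generate_topology (UNIV :: bool set set)"
    by (auto simp: fun_eq_iff open_discrete intro: generate_topology.Basis)
  then show "\<exists>B::bool set set. countable B \<and> open = generate_topology B"
    by (intro exI[of _ UNIV]) simp
qed

type_synonym 'r code = "(nat \<Rightarrow> bool) \<times> ('r \<Rightarrow> nat list \<Rightarrow> bool)"

definition univ :: "'r code \<Rightarrow> nat set" where
  "univ A = {n. fst A n}"

definition rel :: "'r code \<Rightarrow> 'r \<Rightarrow> nat list \<Rightarrow> bool" where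
  "rel A = snd A"

definition structures :: "('r \<Rightarrow> nat) \<Rightarrow> 'r code set" where
  "structures ar = {A. \<forall>r xs. rel A r xs \<longrightarrow> length xs = ar r \<and> xs \<in> lists (univ A)}"

text \<open>
  Maps between structures are coded by functions that are \<open>undefined\<close> outside of the universe of
  the domain, so that every map has exactly one code.
\<close>

definition embeddings :: "'r code \<Rightarrow> 'r code \<Rightarrow> (nat \<Rightarrow> nat) set" where
  "embeddings A B = {f \<in> univ A \<rightarrow>\<^sub>E univ B. inj_on f (univ A) \<and>
     (\<forall>r. \<forall>xs\<in>lists (univ A). rel A r xs \<longleftrightarrow> rel B r (map f xs))}"

definition isos :: "'r code \<Rightarrow> 'r code \<Rightarrow> (nat \<Rightarrow> nat) set" where
  "isos A B = {f \<in> embeddings A B. f ` univ A = univ B}"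

definition auts :: "'r code \<Rightarrow> (nat \<Rightarrow> nat) set" where
  "auts A = isos A A"

definition structure_class :: "('r::countable \<Rightarrow> nat) \<Rightarrow> 'r code set \<Rightarrow> bool" where
  "structure_class ar K \<longleftrightarrow> K \<subseteq> structures ar \<and> K \<in> sets borel \<and>
     (\<forall>A\<in>K. \<forall>B\<in>structures ar. isos A B \<noteq> {} \<longrightarrow> B \<in> K)"

datatype qf_term = X | Param nat

datatype 'r qf_formula =
    Eq qf_term qf_term
  | Rel 'r "qf_term list"
  | Neg "'r qf_formula"
  | Conj "'r qf_formula" "'r qf_formula"

primrec term_params :: "qf_term \<Rightarrow> nat set" where
  "term_params X = {}"
| "term_params (Param a) = {a}"

primrec params :: "'r qf_formula \<Rightarrow> nat set" where
  "params (Eq s t) = term_params s \<union> term_params t"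
| "params (Rel r ts) = (\<Union>t\<in>set ts. term_params t)"
| "params (Neg p) = params p"
| "params (Conj p q) = params p \<union> params q"

primrec well_formed :: "('r \<Rightarrow> nat) \<Rightarrow> 'r qf_formula \<Rightarrow> bool" where
  "well_formed ar (Eq s t) \<longleftrightarrow> True"
| "well_formed ar (Rel r ts) \<longleftrightarrow> length ts = ar r"
| "well_formed ar (Neg p) \<longleftrightarrow> well_formed ar p"
| "well_formed ar (Conj p q) \<longleftrightarrow> well_formed ar p \<and> well_formed ar q"

primrec term_val :: "(nat \<Rightarrow> nat) \<Rightarrow> nat \<Rightarrow> qf_term \<Rightarrow> nat" where
  "term_val j b X = b"
| "term_val j b (Param a) = j a"

text \<open>Satisfaction in \<open>B\<close>, where a parameter \<open>a\<close> is interpreted as \<open>j a\<close> and the variable as \<open>b\<close>.\<close>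

primrec sat :: "'r code \<Rightarrow> (nat \<Rightarrow> nat) \<Rightarrow> nat \<Rightarrow> 'r qf_formula \<Rightarrow> bool" where
  "sat B j b (Eq s t) \<longleftrightarrow> term_val j b s = term_val j b t"
| "sat B j b (Rel r ts) \<longleftrightarrow> rel B r (map (term_val j b) ts)"
| "sat B j b (Neg p) \<longleftrightarrow> \<not> sat B j b p"
| "sat B j b (Conj p q) \<longleftrightarrow> sat B j b p \<and> sat B j b q"

text \<open>
  Types need not be complete; the complete types over the finite parameter set are among them.
\<close>

definition finite_types :: "('r \<Rightarrow> nat) \<Rightarrow> 'r code \<Rightarrow> 'r qf_formula set set" where
  "finite_types ar A = {\<tau>. \<exists>F. finite F \<and> F \<subseteq> univ A \<and>
     (\<forall>p\<in>\<tau>. well_formed ar p \<and> params p \<subseteq> F)}"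

definition realizes :: "'r code \<Rightarrow> (nat \<Rightarrow> nat) \<Rightarrow> nat \<Rightarrow> 'r qf_formula set \<Rightarrow> bool" where
  "realizes B j b \<tau> \<longleftrightarrow> b \<in> univ B \<and> (\<forall>p\<in>\<tau>. sat B j b p)"

text \<open>
  A structure whose universe is all of the natural numbers has no proper extension among the codes.
  An extension of \<open>A\<close> is therefore a structure \<open>B\<close> together with an embedding \<open>j\<close> of \<open>A\<close> into \<open>B\<close>,
  through which \<open>A\<close> is identified with a substructure of \<open>B\<close>.
\<close>

definition admissible_types ::
    "('r \<Rightarrow> nat) \<Rightarrow> 'r code set \<Rightarrow> 'r code \<Rightarrow> 'r qf_formula set set" where
  "admissible_types ar K A = {\<tau> \<in> finite_types ar A.
     \<exists>B\<in>K. \<exists>j\<in>embeddings A B. \<exists>b. realizes B j b \<tau>}"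

text \<open>
  In the following, \<open>\<iota> A\<close> is the inclusion of \<open>A\<close> into its extension \<open>E A\<close>. It has to depend on \<open>A\<close>
  in a Borel way, so that passing to \<open>E A\<close> includes finding \<open>A\<close> inside \<open>E A\<close>.
\<close>

definition ABAP :: "('r::countable \<Rightarrow> nat) \<Rightarrow> 'r code set \<Rightarrow> bool" where
  "ABAP ar K \<longleftrightarrow> structure_class ar K \<and>
    (\<exists>(E :: 'r code \<Rightarrow> 'r code)
      (\<iota> :: 'r code \<Rightarrow> nat \<Rightarrow> nat)
      (tilde :: 'r code \<Rightarrow> (nat \<Rightarrow> nat) \<Rightarrow> nat \<Rightarrow> nat)
      (hat :: 'r code \<Rightarrow> 'r code \<Rightarrow> (nat \<Rightarrow> nat) \<Rightarrow> nat \<Rightarrow> nat).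
      E \<in> restrict_space borel K \<rightarrow>\<^sub>M borel \<and>
      \<iota> \<in> restrict_space borel K \<rightarrow>\<^sub>M borel \<and>
      (\<lambda>(A, \<phi>). tilde A \<phi>) \<in> restrict_space borel {(A, \<phi>). A \<in> K \<and> \<phi> \<in> auts A} \<rightarrow>\<^sub>M borel \<and>
      (\<forall>A\<in>K. E A \<in> K \<and> \<iota> A \<in> embeddings A (E A) \<and>
        (\<forall>\<tau>\<in>admissible_types ar K A. \<exists>b. realizes (E A) (\<iota> A) b \<tau>)) \<and>
      (\<forall>A\<in>K. \<forall>\<phi>\<in>auts A. tilde A \<phi> \<in> auts (E A) \<and>
        (\<forall>x\<in>univ A. tilde A \<phi> (\<iota> A x) = \<iota> A (\<phi> x)) \<and>
        (\<forall>y\<in>univ (E A) - \<iota> A ` univ A. tilde A \<phi> y \<noteq> y)) \<and>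
      (\<forall>A\<^sub>0\<in>K. \<forall>A\<^sub>1\<in>K. \<forall>\<alpha>\<in>isos A\<^sub>0 A\<^sub>1. hat A\<^sub>0 A\<^sub>1 \<alpha> \<in> isos (E A\<^sub>0) (E A\<^sub>1) \<and>
        (\<forall>x\<in>univ A\<^sub>0. hat A\<^sub>0 A\<^sub>1 \<alpha> (\<iota> A\<^sub>0 x) = \<iota> A\<^sub>1 (\<alpha> x)) \<and>
        (\<forall>\<phi>\<^sub>0\<in>auts A\<^sub>0. \<forall>\<phi>\<^sub>1\<in>auts A\<^sub>1.
          (\<forall>x\<in>univ A\<^sub>0. \<alpha> (\<phi>\<^sub>0 x) = \<phi>\<^sub>1 (\<alpha> x)) \<longrightarrow>
          (\<forall>y\<in>univ (E A\<^sub>0).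
            hat A\<^sub>0 A\<^sub>1 \<alpha> (tilde A\<^sub>0 \<phi>\<^sub>0 y) = tilde A\<^sub>1 \<phi>\<^sub>1 (hat A\<^sub>0 A\<^sub>1 \<alpha> y)))))"

text \<open>The language of orders has the single symbol \<open>()\<close>, read as \<open><\<close>.\<close>

definition order_arity :: "unit \<Rightarrow> nat" where
  "order_arity r = 2"

definition linear_orders :: "unit code set" where
  "linear_orders = {A \<in> structures order_arity.
     strict_linear_order_on (univ A) {(x, y). rel A () [x, y]}}"

end

theory Submission
  imports Defs
begin

text \<open>
  The extension of a linear order \<open>L\<close> is obtained by inserting a copy of the integers below \<open>L\<close> and
  another one immediately above every point of \<open>L\<close>. These copies meet every cut determined by
  finitely many points of \<open>L\<close>. An automorphism of \<open>L\<close> permutes the copies; letting it moreover add 1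
  to every integer leaves no new point fixed, even when the copy itself is preserved.
  Isomorphisms act on the copies without a shift, and hence commute with the shifts.
\<close>

section \<open>Linear orders and their embeddings on the level of codes\<close>

definition less_in :: "unit code \<Rightarrow> nat \<Rightarrow> nat \<Rightarrow> bool" where
  "less_in A x y \<longleftrightarrow> rel A () [x, y]"

text \<open>A form in which every quantifier ranges over a countable set and every atom is a
  coordinate of the code, so that the class is visibly Borel.\<close>

lemma linear_orders_iff:
  "A \<in> linear_orders \<longleftrightarrow>
    (\<forall>xs. rel A () xs \<longrightarrow> (\<exists>x y. xs = [x, y] \<and> x \<in> univ A \<and> y \<in> univ A)) \<and>
    (\<forall>x. \<not> less_in A x x) \<and>
    (\<forall>x y z. less_in A x y \<longrightarrow> less_in A y z \<longrightarrow> less_in A x z) \<and>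
    (\<forall>x\<in>univ A. \<forall>y\<in>univ A. x \<noteq> y \<longrightarrow> less_in A x y \<or> less_in A y x)"
proof -
  have "A \<in> structures order_arity \<longleftrightarrow>
      (\<forall>xs. rel A () xs \<longrightarrow> (\<exists>x y. xs = [x, y] \<and> x \<in> univ A \<and> y \<in> univ A))"
    by (fastforce simp: structures_def order_arity_def numeral_2_eq_2 length_Suc_conv)
  then show ?thesis
    by (auto simp: linear_orders_def strict_linear_order_on_def trans_def irrefl_def total_on_def
        less_in_def)
qed

lemma less_in_irrefl: "A \<in> linear_orders \<Longrightarrow> \<not> less_in A x x"
  and less_in_trans: "A \<in> linear_orders \<Longrightarrow> less_in A x y \<Longrightarrow> less_in A y z \<Longrightarrow> less_in A x z"
  and less_in_total: "A \<in> linear_orders \<Longrightarrow> x \<in> univ A \<Longrightarrow> y \<in> univ A \<Longrightarrow>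
    x \<noteq> y \<Longrightarrow> less_in A x y \<or> less_in A y x"
  and less_in_univ: "A \<in> linear_orders \<Longrightarrow> less_in A x y \<Longrightarrow> x \<in> univ A \<and> y \<in> univ A"
  unfolding linear_orders_iff less_in_def by blast+

lemma rel_linear_order:
  "A \<in> linear_orders \<Longrightarrow> rel A r xs \<longleftrightarrow> (\<exists>x y. xs = [x, y] \<and> less_in A x y)"
  unfolding linear_orders_iff less_in_def by (cases r) blast

lemma less_in_embedding_iff:
  assumes "f \<in> embeddings A B" "x \<in> univ A" "y \<in> univ A"
  shows "less_in B (f x) (f y) \<longleftrightarrow> less_in A x y"
proof -
  have "[x, y] \<in> lists (univ A)" using assms by simp
  then have "rel A () [x, y] \<longleftrightarrow> rel B () (map f [x, y])"
    using assms(1) unfolding embeddings_def by blast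
  then show ?thesis by (simp add: less_in_def)
qed

text \<open>By totality of \<open>A\<close>, points with \<open>x < y\<close> false satisfy
  \<open>x = y\<close> or \<open>y < x\<close>, and either excludes \<open>f x < f y\<close> in
  \<open>B\<close>. So the order is reflected, and injectivity is the comparability of distinct
  points.\<close>

lemma strictly_monotone_embedding:
  assumes A: "A \<in> linear_orders" and B: "B \<in> linear_orders" and f: "f \<in> univ A \<rightarrow>\<^sub>E univ B"
    and mono: "\<And>x y. less_in A x y \<Longrightarrow> less_in B (f x) (f y)"
  shows "f \<in> embeddings A B"
proof -
  have iff: "less_in A x y \<longleftrightarrow> less_in B (f x) (f y)" if "x \<in> univ A" "y \<in> univ A" for x y
    by (metis A B mono less_in_irrefl less_in_total less_in_trans that)
  have "inj_on f (univ A)"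
    by (metis A B inj_onI mono less_in_irrefl less_in_total)
  moreover have "rel A r xs \<longleftrightarrow> rel B r (map f xs)" if "xs \<in> lists (univ A)" for r xs
    using that by (auto simp: rel_linear_order[OF A] rel_linear_order[OF B] map_eq_Cons_conv iff)
  ultimately show ?thesis using f by (simp add: embeddings_def)
qed

section \<open>The linear orders form a Borel class closed under isomorphism\<close>

text \<open>In a countable Hausdorff space every set is a countable union of closed points, hence
  Borel. This turns continuity of coordinates into facts about \<open>count_space\<close>.\<close>

lemma measurable_borel_count_space:
  "f \<in> M \<rightarrow>\<^sub>M (borel :: 'a::{countable, t2_space} measure) \<longleftrightarrow> f \<in> M \<rightarrow>\<^sub>M count_space UNIV"
  using measurable_cong_sets[OF refl sets_borel_eq_count_space] by blast

lemma measurable_fst_code [measurable]: "(\<lambda>A::unit code. fst A n) \<in> borel \<rightarrow>\<^sub>M count_space UNIV"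
  unfolding measurable_borel_count_space[symmetric]
  by (intro borel_measurable_continuous_onI continuous_on_product_then_coordinatewise
      [OF continuous_on_fst[OF continuous_on_id]])

lemma measurable_rel_code [measurable]:
  "(\<lambda>A::unit code. rel A r xs) \<in> borel \<rightarrow>\<^sub>M count_space UNIV"
  unfolding measurable_borel_count_space[symmetric] rel_def
  by (intro borel_measurable_continuous_onI continuous_on_product_then_coordinatewise
      [OF continuous_on_product_then_coordinatewise[OF continuous_on_snd[OF continuous_on_id]]])

lemma measurable_less_in [measurable]: "Measurable.pred borel (\<lambda>A. less_in A x y)"
  unfolding less_in_def by measurable

lemma measurable_apply_nat [measurable]:
  "(\<lambda>f::nat \<Rightarrow> nat. f n) \<in> borel \<rightarrow>\<^sub>M count_space UNIV"
  unfolding measurable_borel_count_space[symmetric]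
  by (intro borel_measurable_continuous_onI continuous_on_product_then_coordinatewise
      [OF continuous_on_id])

lemma sets_linear_orders: "linear_orders \<in> sets borel"
proof -
  have "Measurable.pred borel (\<lambda>A. A \<in> linear_orders)"
    unfolding linear_orders_iff univ_def Ball_def mem_Collect_eq by measurable
  then show ?thesis by (simp add: pred_def)
qed

lemma structure_class_linear_orders: "structure_class order_arity linear_orders"
proof -
  have "B \<in> linear_orders"
    if A: "A \<in> linear_orders" and B: "B \<in> structures order_arity" and f: "f \<in> isos A B" for A B f
  proof -
    have emb: "f \<in> embeddings A B" and im: "f ` univ A = univ B"
      using f by (auto simp: isos_def)
    have rel: "\<exists>x y. xs = [x, y] \<and> x \<in> univ B \<and> y \<in> univ B" if "rel B () xs" for xs
      using B that by (fastforce simp: structures_def order_arity_def numeral_2_eq_2 length_Suc_conv)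
    then have dom: "x \<in> univ B \<and> y \<in> univ B" if "less_in B x y" for x y
      using that by (force simp: less_in_def)
    \<comment> \<open>Surjectivity allows each order axiom of \<open>B\<close> to be pulled back to
      \<open>A\<close>.\<close>
    have preimage: "\<exists>a\<in>univ A. y = f a" if "y \<in> univ B" for y
      using that im by blast
    note iff = less_in_embedding_iff[OF emb]
    have "\<not> less_in B x x" for x
    proof
      assume less: "less_in B x x"
      then obtain a where "a \<in> univ A" "x = f a" using dom preimage by blast
      then show False using less iff less_in_irrefl[OF A] by simp
    qed
    moreover have "less_in B x z" if less: "less_in B x y" "less_in B y z" for x y z
    proof -
      obtain a b c where "a \<in> univ A" "b \<in> univ A" "c \<in> univ A" "x = f a" "y = f b" "z = f c"
        using dom[OF less(1)] dom[OF less(2)] preimage by meson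
      then show ?thesis using less iff less_in_trans[OF A, of a b c] by simp
    qed
    moreover have "less_in B x y \<or> less_in B y x"
      if xy: "x \<in> univ B" "y \<in> univ B" "x \<noteq> y" for x y
    proof -
      obtain a b where "a \<in> univ A" "b \<in> univ A" "x = f a" "y = f b"
        using xy preimage by meson
      then show ?thesis using \<open>x \<noteq> y\<close> iff less_in_total[OF A, of a b] by auto
    qed
    ultimately show ?thesis using rel by (simp add: linear_orders_iff)
  qed
  then show ?thesis
    unfolding structure_class_def using sets_linear_orders
    by (auto simp: linear_orders_def)
qed

section \<open>The extension and its order\<close>

text \<open>
  The number \<open>prod_encode (c, k)\<close> codes a point of the extension: \<open>prod_encode (Suc a, 0)\<close> is the
  old point \<open>a\<close>, and \<open>prod_encode (c, Suc k)\<close> is the integer \<open>int_decode k\<close> in the copy above \<open>a\<close> if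
  \<open>c = Suc a\<close>, and in the copy below all of the order if \<open>c = 0\<close>.
\<close>

definition is_point :: "unit code \<Rightarrow> nat \<times> nat \<Rightarrow> bool" where
  "is_point A p \<longleftrightarrow> (case fst p of 0 \<Rightarrow> snd p \<noteq> 0 | Suc a \<Rightarrow> fst A a)"

definition copy_less :: "unit code \<Rightarrow> nat \<Rightarrow> nat \<Rightarrow> bool" where
  "copy_less A c d \<longleftrightarrow>
    (case d of 0 \<Rightarrow> False | Suc b \<Rightarrow> (case c of 0 \<Rightarrow> fst A b | Suc a \<Rightarrow> less_in A a b))"

definition int_less :: "nat \<Rightarrow> nat \<Rightarrow> bool" where
  "int_less k l \<longleftrightarrow>
    (case l of 0 \<Rightarrow> False | Suc l' \<Rightarrow>
      (case k of 0 \<Rightarrow> True | Suc k' \<Rightarrow> int_decode k' < int_decode l'))"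

text \<open>This is a lexicographic order. All points with the same first coordinate form a block;
  the blocks are ordered as \<open>A\<close> with block \<open>0\<close> added at the bottom. Index
  \<open>0\<close>, the old point, is least in its block, so the integers of the block fill the gap
  directly above it.\<close>

definition point_less :: "unit code \<Rightarrow> nat \<times> nat \<Rightarrow> nat \<times> nat \<Rightarrow> bool" where
  "point_less A p q \<longleftrightarrow> is_point A p \<and> is_point A q \<and>
    (copy_less A (fst p) (fst q) \<or> fst p = fst q \<and> int_less (snd p) (snd q))"

definition ext :: "unit code \<Rightarrow> unit code" where
  "ext A = (\<lambda>n. is_point A (prod_decode n),
    \<lambda>r xs. case xs of [m, n] \<Rightarrow> point_less A (prod_decode m) (prod_decode n) | _ \<Rightarrow> False)"

definition incl :: "unit code \<Rightarrow> nat \<Rightarrow> nat" where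
  "incl A a = (if fst A a then prod_encode (Suc a, 0) else undefined)"

definition copy_map :: "(nat \<Rightarrow> nat) \<Rightarrow> nat \<Rightarrow> nat" where
  "copy_map f c = (case c of 0 \<Rightarrow> 0 | Suc a \<Rightarrow> Suc (f a))"

text \<open>Index \<open>0\<close> stays fixed, so that a lift using \<open>shift\<close> still
  extends the given map on old points.\<close>

definition shift :: "nat \<Rightarrow> nat" where
  "shift k = (case k of 0 \<Rightarrow> 0 | Suc k' \<Rightarrow> Suc (int_encode (int_decode k' + 1)))"

text \<open>The parameter \<open>s\<close> acts inside the blocks: it is \<open>shift\<close> for
  the lifts of automorphisms and \<open>id\<close> for those of isomorphisms.\<close>

definition ext_map :: "(nat \<Rightarrow> nat) \<Rightarrow> unit code \<Rightarrow> (nat \<Rightarrow> nat) \<Rightarrow> nat \<Rightarrow> nat" where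
  "ext_map s A f n = (if is_point A (prod_decode n)
    then case prod_decode n of (c, k) \<Rightarrow> prod_encode (copy_map f c, s k) else undefined)"

lemma fst_ext: "fst (ext A) n \<longleftrightarrow> is_point A (prod_decode n)"
  by (simp add: ext_def)

lemma univ_ext: "univ (ext A) = {n. is_point A (prod_decode n)}"
  by (simp add: univ_def fst_ext)

lemma less_in_ext: "less_in (ext A) m n \<longleftrightarrow> point_less A (prod_decode m) (prod_decode n)"
  by (simp add: less_in_def rel_def ext_def)

lemma ext_linear_order:
  assumes A: "A \<in> linear_orders"
  shows "ext A \<in> linear_orders"
proof -
  have copy_irrefl: "\<not> copy_less A c c" for c
    using less_in_irrefl[OF A] by (simp add: copy_less_def split: nat.split)
  \<comment> \<open>When \<open>c\<close> is block \<open>0\<close>, it must be known that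
    \<open>e\<close> belongs to a point of \<open>A\<close>; this is where
    \<open>less_in_univ\<close> enters.\<close>
  have copy_trans: "copy_less A c e" if "copy_less A c d" "copy_less A d e" for c d e
    using that less_in_trans[OF A] less_in_univ[OF A]
    by (auto simp: copy_less_def univ_def split: nat.splits)
  have int_irrefl: "\<not> int_less k k" for k
    by (simp add: int_less_def split: nat.split)
  have int_trans: "int_less k m" if "int_less k l" "int_less l m" for k l m
    using that by (auto simp: int_less_def split: nat.splits)
  have int_total: "int_less k l \<or> int_less l k" if "k \<noteq> l" for k l
    using that by (auto simp: int_less_def split: nat.splits)
      (metis int_decode_inverse linorder_less_linear)
  have copy_total: "copy_less A (fst p) (fst q) \<or> copy_less A (fst q) (fst p)"
    if "is_point A p" "is_point A q" "fst p \<noteq> fst q" for p q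
    using that less_in_total[OF A]
    by (auto simp: copy_less_def is_point_def univ_def split: nat.splits)
  have "\<not> point_less A p p" for p
    by (simp add: point_less_def copy_irrefl int_irrefl)
  moreover have "point_less A p r" if "point_less A p q" "point_less A q r" for p q r
    using that copy_trans[of "fst p" "fst q" "fst r"] int_trans[of "snd p" "snd q" "snd r"]
    by (auto simp: point_less_def)
  moreover have "point_less A (prod_decode x) (prod_decode y) \<or>
      point_less A (prod_decode y) (prod_decode x)"
    if "x \<in> univ (ext A)" "y \<in> univ (ext A)" "x \<noteq> y" for x y
  proof -
    have points: "is_point A (prod_decode x)" "is_point A (prod_decode y)"
      using that by (simp_all add: univ_ext)
    have "prod_decode x \<noteq> prod_decode y" using that by (simp add: prod_decode_eq)
    then consider "fst (prod_decode x) \<noteq> fst (prod_decode y)"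
      | "fst (prod_decode x) = fst (prod_decode y)" "snd (prod_decode x) \<noteq> snd (prod_decode y)"
      by (auto simp: prod_eq_iff)
    then show ?thesis
    proof cases
      case 1
      then show ?thesis using copy_total[OF points] points by (auto simp: point_less_def)
    next
      case 2
      then show ?thesis using int_total[OF 2(2)] points by (auto simp: point_less_def)
    qed
  qed
  moreover have "\<exists>x y. xs = [x, y] \<and> x \<in> univ (ext A) \<and> y \<in> univ (ext A)"
    if "rel (ext A) () xs" for xs
    using that by (auto simp: rel_def ext_def univ_def point_less_def split: list.splits)
  ultimately show ?thesis
    unfolding linear_orders_iff less_in_ext by blast
qed

lemma incl_embedding:
  assumes A: "A \<in> linear_orders"
  shows "incl A \<in> embeddings A (ext A)"
  using less_in_univ[OF A]
  by (intro strictly_monotone_embedding[OF A ext_linear_order[OF A]])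
    (auto simp: fst_ext less_in_ext incl_def is_point_def point_less_def copy_less_def univ_def
      split: if_splits)

section \<open>Realizing the admissible finite types\<close>

text \<open>Atoms between two parameters are transferred by the embeddings, atoms between a
  parameter and the variable by the hypotheses, and the variable against itself by irreflexivity.
  Induction covers the connectives.\<close>

lemma sat_eq_if_same_cut:
  assumes B: "B \<in> linear_orders" and C: "C \<in> linear_orders"
    and i: "i \<in> embeddings A B" and j: "j \<in> embeddings A C" and F: "F \<subseteq> univ A"
    and eq: "\<And>a. a \<in> F \<Longrightarrow> b = i a \<longleftrightarrow> c = j a"
    and below: "\<And>a. a \<in> F \<Longrightarrow> less_in B b (i a) \<longleftrightarrow> less_in C c (j a)"
    and above: "\<And>a. a \<in> F \<Longrightarrow> less_in B (i a) b \<longleftrightarrow> less_in C (j a) c"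
    and "params p \<subseteq> F"
  shows "sat B i b p \<longleftrightarrow> sat C j c p"
proof -
  have inj: "i a = i a' \<longleftrightarrow> j a = j a'" if "a \<in> F" "a' \<in> F" for a a'
    using i j F that unfolding embeddings_def inj_on_def by blast
  have terms_eq: "term_val i b s = term_val i b t \<longleftrightarrow> term_val j c s = term_val j c t"
    if "term_params s \<subseteq> F" "term_params t \<subseteq> F" for s t
    using that inj eq by (cases s; cases t) (auto dest: sym)
  have less: "less_in B (i a) (i a') \<longleftrightarrow> less_in C (j a) (j a')" if "a \<in> F" "a' \<in> F" for a a'
    using that F less_in_embedding_iff[OF i] less_in_embedding_iff[OF j] by blast
  have terms_less:
    "less_in B (term_val i b s) (term_val i b t) \<longleftrightarrow> less_in C (term_val j c s) (term_val j c t)"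
    if "term_params s \<subseteq> F" "term_params t \<subseteq> F" for s t
    using that less below above less_in_irrefl[OF B] less_in_irrefl[OF C]
    by (cases s; cases t) auto
  from \<open>params p \<subseteq> F\<close> show ?thesis
  proof (induction p)
    case (Eq s t)
    then show ?case using terms_eq by simp
  next
    case (Rel r ts)
    show ?case
    proof (cases "\<exists>s t. ts = [s, t]")
      case True
      then show ?thesis using Rel terms_less
        by (auto simp: rel_linear_order[OF B] rel_linear_order[OF C])
    next
      \<comment> \<open>An argument list that is not a pair satisfies the relation in neither
        order.\<close>
      case False
      then show ?thesis
        by (auto simp: rel_linear_order[OF B] rel_linear_order[OF C] map_eq_Cons_conv)
    qed
  qed simp_all
qed

text \<open>Applied to the parameters below a cut, this finds the block in which the cut is to be
  filled.\<close>

lemma finite_linear_order_max: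
  assumes A: "A \<in> linear_orders" and "finite S" "S \<subseteq> univ A" "S \<noteq> {}"
  shows "\<exists>m\<in>S. \<forall>a\<in>S. a = m \<or> less_in A a m"
  using assms(2,4,3)
proof (induction S rule: finite_ne_induct)
  case (insert x S)
  then obtain m where m: "m \<in> S" "\<forall>a\<in>S. a = m \<or> less_in A a m" by auto
  then have "x = m \<or> less_in A x m \<or> less_in A m x"
    using insert.prems less_in_total[OF A] by blast
  then show ?case
    using m less_in_trans[OF A] by (metis insert_iff)
qed simp

text \<open>A realization in \<open>B\<close> either equals a parameter or determines a cut in the
  finite set \<open>F\<close>. In the first case the old point serves; in the second, an integer in
  the block of the greatest parameter below the cut, or in block \<open>0\<close> if there is
  none.\<close>

lemma admissible_type_realized:
  assumes A: "A \<in> linear_orders" and \<tau>: "\<tau> \<in> admissible_types order_arity linear_orders A"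
  shows "\<exists>c. realizes (ext A) (incl A) c \<tau>"
proof -
  obtain B j b F where B: "B \<in> linear_orders" and j: "j \<in> embeddings A B"
    and b: "realizes B j b \<tau>" and fin: "finite F" and F: "F \<subseteq> univ A"
    and params: "\<forall>p\<in>\<tau>. params p \<subseteq> F"
    using \<tau> by (auto simp: admissible_types_def finite_types_def)
  note E = ext_linear_order[OF A] and i = incl_embedding[OF A]
  have bB: "b \<in> univ B" using b by (simp add: realizes_def)
  have jB: "j a \<in> univ B" if "a \<in> F" for a
    using j F that by (auto simp: embeddings_def)
  have inclE: "incl A a \<in> univ (ext A)" if "a \<in> F" for a
    using i F that by (auto simp: embeddings_def)
  note j_iff = less_in_embedding_iff[OF j] and i_iff = less_in_embedding_iff[OF i]
  have transfer: ?thesis if "c \<in> univ (ext A)"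
    and "\<And>a. a \<in> F \<Longrightarrow> b = j a \<longleftrightarrow> c = incl A a"
    and "\<And>a. a \<in> F \<Longrightarrow> less_in B b (j a) \<longleftrightarrow> less_in (ext A) c (incl A a)"
    and "\<And>a. a \<in> F \<Longrightarrow> less_in B (j a) b \<longleftrightarrow> less_in (ext A) (incl A a) c" for c
    using sat_eq_if_same_cut[OF B E j i F, of b c] that b params
    by (metis realizes_def)
  show ?thesis
  proof (cases "\<exists>f\<in>F. b = j f")
    case True
    then obtain f where f: "f \<in> F" "b = j f" by blast
    have "j f = j a \<longleftrightarrow> incl A f = incl A a" if "a \<in> F" for a
      using i j F f that unfolding embeddings_def inj_on_def by blast
    then show ?thesis
      using f F j_iff i_iff inclE by (intro transfer[of "incl A f"]) (auto simp: subset_iff)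
  next
    case new: False
    \<comment> \<open>Since \<open>b\<close> differs from all parameters, it suffices to place
      \<open>c\<close> on the correct side of each; asymmetry settles the remaining
      comparisons.\<close>
    have strict: ?thesis if "c \<in> univ (ext A)"
      and c: "\<And>a. a \<in> F \<Longrightarrow>
        (if less_in B (j a) b then less_in (ext A) (incl A a) c else less_in (ext A) c (incl A a))" for c
    proof (rule transfer[OF that(1)])
      fix a assume a: "a \<in> F"
      have *: "less_in B b (j a) \<longleftrightarrow> \<not> less_in B (j a) b"
        using a new bB jB less_in_total[OF B] less_in_trans[OF B] less_in_irrefl[OF B] by metis
      have **: "\<not> (less_in (ext A) x y \<and> less_in (ext A) y x)" for x y
        using less_in_trans[OF E] less_in_irrefl[OF E] by blast
      show "b = j a \<longleftrightarrow> c = incl A a"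
        using c[OF a] new a less_in_irrefl[OF E] by (auto split: if_splits)
      show "less_in B b (j a) \<longleftrightarrow> less_in (ext A) c (incl A a)"
        using c[OF a] * ** by (auto split: if_splits)
      show "less_in B (j a) b \<longleftrightarrow> less_in (ext A) (incl A a) c"
        using c[OF a] * ** by (auto split: if_splits)
    qed
    show ?thesis
    proof (cases "{a \<in> F. less_in B (j a) b} = {}")
      case True
      show ?thesis
        using True F
        by (intro strict[of "prod_encode (0, 1)"])
          (auto simp: fst_ext less_in_ext point_less_def is_point_def copy_less_def incl_def univ_def)
    next
      case False
      then obtain m where m: "m \<in> F" "less_in B (j m) b"
        and max: "\<And>a. a \<in> F \<Longrightarrow> less_in B (j a) b \<Longrightarrow> a = m \<or> less_in A a m"
        using finite_linear_order_max[OF A, of "{a \<in> F. less_in B (j a) b}"] fin F by auto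
      \<comment> \<open>Otherwise \<open>a = m\<close> or \<open>a < m\<close>, and then
        \<open>j a\<close> would be below \<open>b\<close> along with \<open>j m\<close>.\<close>
      have "less_in A m a" if "a \<in> F" "\<not> less_in B (j a) b" for a
        using m that F less_in_total[OF A] j_iff less_in_trans[OF B] by (metis subsetD)
      then show ?thesis
        \<comment> \<open>Index \<open>1\<close> places the witness above the old point
          \<open>m\<close> and before all later blocks, which contain the parameters above the
          cut.\<close>
        using m max F
        by (intro strict[of "prod_encode (Suc m, 1)"])
          (auto simp: fst_ext less_in_ext point_less_def is_point_def copy_less_def int_less_def
            incl_def univ_def)
    qed
  qed
qed

section \<open>Lifting isomorphisms to the extensions\<close>

lemma shift_strict_mono: "int_less k l \<Longrightarrow> int_less (shift k) (shift l)"
  by (auto simp: int_less_def shift_def split: nat.splits)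

lemma shift_eq_0_iff: "shift k = 0 \<longleftrightarrow> k = 0"
  by (simp add: shift_def split: nat.split)

lemma shift_neq: "k \<noteq> 0 \<Longrightarrow> shift k \<noteq> k"
  by (auto simp: shift_def split: nat.split)
    (metis int_encode_inverse add_cancel_left_right zero_neq_one)

lemma surj_shift: "surj shift"
proof (rule surjI)
  fix k show "shift (case k of 0 \<Rightarrow> 0 | Suc l \<Rightarrow> Suc (int_encode (int_decode l - 1))) = k"
    by (simp add: shift_def split: nat.split)
qed

lemma ext_map_incl:
  assumes "f \<in> univ A \<rightarrow> univ B" "s 0 = 0" "x \<in> univ A"
  shows "ext_map s A f (incl A x) = incl B (f x)"
proof -
  have "fst A x" "fst B (f x)" using assms by (auto simp: univ_def)
  then show ?thesis
    using assms(2) by (simp add: ext_map_def incl_def is_point_def copy_map_def)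
qed

text \<open>The lift moves blocks by \<open>f\<close> and indices by \<open>s\<close>, each strictly
  increasing, hence is increasing for the lexicographic order. The condition on \<open>0\<close>
  keeps old points old and respects the absence of index \<open>0\<close> in block
  \<open>0\<close>.\<close>

lemma ext_map_iso:
  assumes A: "A \<in> linear_orders" and B: "B \<in> linear_orders" and f: "f \<in> isos A B"
    and s: "\<And>k l. int_less k l \<Longrightarrow> int_less (s k) (s l)" "\<And>k. s k = 0 \<longleftrightarrow> k = 0" "surj s"
  shows "ext_map s A f \<in> isos (ext A) (ext B)"
proof -
  have emb: "f \<in> embeddings A B" and im: "f ` univ A = univ B"
    using f by (auto simp: isos_def)
  have point: "is_point B (copy_map f c, s k)" if "is_point A (c, k)" for c k
    using that im s(2) by (auto simp: is_point_def copy_map_def univ_def split: nat.splits)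
  have "copy_less B (copy_map f c) (copy_map f d)" if "copy_less A c d" for c d
    using that im less_in_univ[OF A] less_in_embedding_iff[OF emb]
    by (auto simp: copy_less_def copy_map_def univ_def split: nat.splits)
  then have less: "point_less B (copy_map f c, s k) (copy_map f d, s l)"
    if "point_less A (c, k) (d, l)" for c k d l
    using that point s(1) by (auto simp: point_less_def)
  have "ext_map s A f \<in> embeddings (ext A) (ext B)"
  proof (rule strictly_monotone_embedding[OF ext_linear_order[OF A] ext_linear_order[OF B]])
    show "ext_map s A f \<in> univ (ext A) \<rightarrow>\<^sub>E univ (ext B)"
      using point by (auto simp: univ_ext ext_map_def split: prod.split if_splits)
    show "less_in (ext B) (ext_map s A f x) (ext_map s A f y)" if "less_in (ext A) x y" for x y
      using that less
      by (cases "prod_decode x"; cases "prod_decode y")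
        (auto simp: less_in_ext ext_map_def point_less_def)
  qed
  moreover have "univ (ext B) \<subseteq> ext_map s A f ` univ (ext A)"
  proof
    fix y assume "y \<in> univ (ext B)"
    then have yB: "is_point B (prod_decode y)" by (simp add: univ_ext)
    obtain d l where y: "y = prod_encode (d, l)" by (metis prod_decode_inverse surj_pair)
    have d: "is_point B (d, l)" using yB y by simp
    obtain k where k: "s k = l" using s(3) by (metis surjD)
    have "\<exists>c. is_point A (c, k) \<and> copy_map f c = d"
    proof (cases d)
      case 0
      \<comment> \<open>Needed because \<open>(0, 0)\<close> is not a point.\<close>
      then have "k \<noteq> 0" using d k s(2)[of k] by (simp add: is_point_def)
      then have "is_point A (0, k)" "copy_map f 0 = d"
        using 0 by (simp_all add: is_point_def copy_map_def)
      then show ?thesis by blast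
    next
      case (Suc b)
      then have "b \<in> f ` univ A" using d im by (simp add: is_point_def univ_def)
      then obtain a where "a \<in> univ A" "f a = b" by blast
      then have "is_point A (Suc a, k)" "copy_map f (Suc a) = d"
        using Suc by (simp_all add: is_point_def copy_map_def univ_def)
      then show ?thesis by blast
    qed
    then obtain c where "is_point A (c, k)" "copy_map f c = d" by blast
    then have "prod_encode (c, k) \<in> univ (ext A)" "y = ext_map s A f (prod_encode (c, k))"
      using k y by (simp_all add: ext_map_def univ_ext)
    then show "y \<in> ext_map s A f ` univ (ext A)" by blast
  qed
  ultimately show ?thesis by (auto simp: isos_def embeddings_def)
qed

lemma ext_map_shift_neq:
  assumes "y \<in> univ (ext A) - incl A ` univ A"
  shows "ext_map shift A f y \<noteq> y"
proof -
  obtain c k where y: "y = prod_encode (c, k)" by (metis prod_decode_inverse surj_pair)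
  \<comment> \<open>Index \<open>0\<close> occurs only in blocks \<open>Suc a\<close>, where it is
    the image of \<open>a\<close> under \<open>incl\<close>.\<close>
  have "k \<noteq> 0"
    using assms y by (auto simp: fst_ext is_point_def incl_def univ_def image_iff split: nat.splits)
  then show ?thesis using assms y shift_neq by (auto simp: ext_map_def univ_ext)
qed

text \<open>With \<open>id\<close> inside the blocks, the lift of \<open>h\<close> changes only the
  block and \<open>s\<close> changes only the index. What remains is the commutation of the block
  maps, which is the one assumed on \<open>A\<close>.\<close>

lemma ext_map_commute:
  assumes f: "f \<in> univ A \<rightarrow> univ A" "h \<in> univ A \<rightarrow> univ B"
    and commute: "\<forall>x\<in>univ A. h (f x) = g (h x)" and s: "\<And>k. s k = 0 \<longleftrightarrow> k = 0"
    and y: "y \<in> univ (ext A)"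
  shows "ext_map id A h (ext_map s A f y) = ext_map s B g (ext_map id A h y)"
proof -
  obtain c k where ck: "y = prod_encode (c, k)" by (metis prod_decode_inverse surj_pair)
  then have "is_point A (c, k)" using y by (simp add: univ_ext)
  moreover from this have "is_point A (copy_map f c, s k)" "is_point B (copy_map h c, k)"
    "copy_map h (copy_map f c) = copy_map g (copy_map h c)"
    using f commute s by (auto simp: is_point_def copy_map_def univ_def split: nat.splits)
  ultimately show ?thesis by (simp add: ext_map_def ck)
qed

section \<open>Borel measurability of the construction\<close>

lemma measurable_is_point [measurable]: "Measurable.pred borel (\<lambda>A. is_point A p)"
  unfolding is_point_def by (cases "fst p") simp_all

lemma measurable_copy_less [measurable]: "Measurable.pred borel (\<lambda>A. copy_less A c d)"
  unfolding copy_less_def by (cases c; cases d) simp_all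

lemma measurable_point_less [measurable]: "Measurable.pred borel (\<lambda>A. point_less A p q)"
  unfolding point_less_def by measurable

text \<open>A map into a countable product is Borel if its coordinates are, and each coordinate of
  \<open>ext A\<close> is decided by finitely many coordinates of \<open>A\<close>.\<close>

lemma measurable_ext: "ext \<in> borel \<rightarrow>\<^sub>M borel"
proof -
  have "Measurable.pred borel
    (\<lambda>A. case xs of [m, n] \<Rightarrow> point_less A (prod_decode m) (prod_decode n) | _ \<Rightarrow> False)" for xs
    by (auto split: list.split)
  then show ?thesis
    unfolding ext_def
    by (intro borel_measurable_Pair measurable_coordinatewise_then_product)
      (simp_all add: measurable_borel_count_space)
qed

lemma measurable_incl: "incl \<in> borel \<rightarrow>\<^sub>M borel"
  by (intro measurable_coordinatewise_then_product)
    (simp add: measurable_borel_count_space incl_def)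

lemma measurable_ext_map: "(\<lambda>(A, f). ext_map s A f) \<in> borel \<rightarrow>\<^sub>M borel"
proof -
  have "(\<lambda>z. ext_map s (fst z) (snd z)) \<in> borel \<Otimes>\<^sub>M borel \<rightarrow>\<^sub>M borel"
  proof (intro measurable_coordinatewise_then_product)
    fix n
    \<comment> \<open>For fixed \<open>n\<close> the block and index are constants, so the value
      depends on whether the point exists and on at most one value of \<open>f\<close>.\<close>
    obtain c k where "prod_decode n = (c, k)" by force
    then show "(\<lambda>z. ext_map s (fst z) (snd z) n) \<in> borel \<Otimes>\<^sub>M borel \<rightarrow>\<^sub>M borel"
      by (cases c)
        (simp_all add: measurable_borel_count_space ext_map_def copy_map_def cong: if_cong)
  qed
  \<comment> \<open>Both spaces are second countable, so the product sigma-algebra is the Borel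
    sigma-algebra of the product.\<close>
  then show ?thesis by (simp add: borel_prod case_prod_unfold)
qed

theorem theorem3p1:
  shows "ABAP order_arity linear_orders"
proof -
  have auts: "ext_map shift A f \<in> auts (ext A)" if "A \<in> linear_orders" "f \<in> auts A" for A f
    using that ext_map_iso[OF _ _ _ shift_strict_mono shift_eq_0_iff surj_shift]
    by (simp add: auts_def)
  have isos: "ext_map id A f \<in> isos (ext A) (ext B)"
    if "A \<in> linear_orders" "B \<in> linear_orders" "f \<in> isos A B" for A B f
    using that by (intro ext_map_iso) auto
  have maps: "f \<in> univ A \<rightarrow> univ B" if "f \<in> isos A B" for A B :: "unit code" and f
    using that by (auto simp: isos_def embeddings_def)
  show ?thesis
    unfolding ABAP_def
    using structure_class_linear_orders measurable_ext measurable_incl measurable_ext_map[of shift]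
      ext_linear_order incl_embedding admissible_type_realized auts isos
    \<comment> \<open>All maps are Borel on the whole space of codes and are then restricted. The
      lift \<open>hat\<close> can ignore the target order, because the new block is read off from
      the isomorphism itself.\<close>
    by (intro conjI exI[of _ ext] exI[of _ incl] exI[of _ "ext_map shift"]
        exI[of _ "\<lambda>A B. ext_map id A"] ballI impI)
      (auto intro!: measurable_restrict_space1 ext_map_incl ext_map_shift_neq ext_map_commute maps
        simp: auts_def shift_eq_0_iff)
qed

end
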